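(* Let $G = G_2(\alpha,2,0,\delta,-)$ be a metacyclic $2$-group of negative type (with $\beta=2$ and $\epsilon=0$). (i) If $\delta=0$, then $\eta(G)=\alpha+3$. (ii) If $\delta=1$, then $\eta(G)=\alpha+2$.
   Context: For a finite group $G$, a maximal cyclic subgroup is a cyclic subgroup not properly contained in any other cyclic subgroup, and $\eta(G)$ is the number of conjugacy classes of maximal cyclic subgroups of $G$. Write $x^y = y^{-1}xy$. For integers $\alpha,\beta>0$, $\delta\ge 0$, $\epsilon\in\{0,1\}$ with $\delta\le\beta$, $\alpha-\delta\ge 2$ and $\delta+\epsilon\le\alpha$ (and $\beta\ge\delta+1$ when $\epsilon=1$), the metacyclic $2$-group of negative type is $$G_2(\alpha,\beta,\epsilon,\delta,-)=\langle x,y \mid x^{2^\alpha}=1,\ y^{2^\beta}=x^{2^{\alpha-\epsilon}},\ x^y=x^{r}\rangle,\quad r=2^{\alpha-\delta}-1.$$ It has order $2^{\alpha+\beta}$. *)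

theory Defs
  imports "HOL-Algebra.Algebra"
begin

section \<open>Groups given by generators and relations\<close>

text \<open>
  A word is a list of letters; \<open>(s, True)\<close> stands for the generator \<open>s\<close> and
  \<open>(s, False)\<close> for its inverse. A relation \<open>u = v\<close> is the pair \<open>(u, v)\<close> of words.
  The group presented by the relations \<open>R\<close> on all elements of type \<open>'s\<close> consists of the
  words modulo the least congruence that contains \<open>R\<close> and cancels adjacent inverse letters.
\<close>

type_synonym 's word = "('s \<times> bool) list"

inductive word_equiv :: "('s word \<times> 's word) set \<Rightarrow> 's word \<Rightarrow> 's word \<Rightarrow> bool"
  for R :: "('s word \<times> 's word) set" where
  refl: "word_equiv R u u"
| sym: "word_equiv R u v \<Longrightarrow> word_equiv R v u"
| trans: "word_equiv R u v \<Longrightarrow> word_equiv R v w \<Longrightarrow> word_equiv R u w"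
| cancel: "word_equiv R (u @ [(s, b), (s, \<not> b)] @ v) (u @ v)"
| rel: "(l, r) \<in> R \<Longrightarrow> word_equiv R (u @ l @ v) (u @ r @ v)"

definition word_class :: "('s word \<times> 's word) set \<Rightarrow> 's word \<Rightarrow> 's word set" where
  "word_class R u = {v. word_equiv R u v}"

definition presented_group :: "('s word \<times> 's word) set \<Rightarrow> 's word set monoid" where
  "presented_group R =
     \<lparr> carrier = UNIV // {(u, v). word_equiv R u v},
       monoid.mult = (\<lambda>A B. {w. \<exists>u\<in>A. \<exists>v\<in>B. word_equiv R (u @ v) w}),
       monoid.one = word_class R [] \<rparr>"

lemma word_equiv_append_left: "word_equiv R u v \<Longrightarrow> word_equiv R (w @ u) (w @ v)"
proof (induction rule: word_equiv.induct)
  case (cancel u s b v)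
  then show ?case using word_equiv.cancel[of R "w @ u" s b v] by simp
next
  case (rel l r u v)
  then show ?case using word_equiv.rel[of l r R "w @ u" v] by simp
qed (auto intro: word_equiv.intros)

lemma word_equiv_append_right: "word_equiv R u v \<Longrightarrow> word_equiv R (u @ w) (v @ w)"
proof (induction rule: word_equiv.induct)
  case (cancel u s b v)
  then show ?case using word_equiv.cancel[of R u s b "v @ w"] by simp
next
  case (rel l r u v)
  then show ?case using word_equiv.rel[of l r R u "v @ w"] by simp
qed (auto intro: word_equiv.intros)

lemma word_equiv_append:
  "word_equiv R u u' \<Longrightarrow> word_equiv R v v' \<Longrightarrow> word_equiv R (u @ v) (u' @ v')"
  by (meson word_equiv.trans word_equiv_append_left word_equiv_append_right)

lemma word_class_eq_iff: "word_class R u = word_class R v \<longleftrightarrow> word_equiv R u v"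
  unfolding word_class_def
  by (auto intro: word_equiv.refl word_equiv.sym word_equiv.trans)

lemma carrier_presented_group: "carrier (presented_group R) = range (word_class R)"
  by (auto simp: presented_group_def quotient_def word_class_def)

lemma one_presented_group: "\<one>\<^bsub>presented_group R\<^esub> = word_class R []"
  by (simp add: presented_group_def)

lemma mult_presented_group:
  "word_class R u \<otimes>\<^bsub>presented_group R\<^esub> word_class R v = word_class R (u @ v)"
  unfolding presented_group_def word_class_def
  by (auto intro: word_equiv.refl word_equiv.sym word_equiv.trans word_equiv_append)

lemma word_equiv_inverse:
  "word_equiv R (map (\<lambda>(s, b). (s, \<not> b)) (rev u) @ u) []"
proof (induction u)
  case Nil
  show ?case by (simp add: word_equiv.refl)
next
  case (Cons a u)
  obtain s b where a: "a = (s, b)" by (cases a)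
  have "word_equiv R (map (\<lambda>(s, b). (s, \<not> b)) (rev (a # u)) @ a # u)
                     (map (\<lambda>(s, b). (s, \<not> b)) (rev u) @ u)"
    using word_equiv.cancel[of R "map (\<lambda>(s, b). (s, \<not> b)) (rev u)" s "\<not> b" u]
    by (simp add: a)
  with Cons show ?case by (blast intro: word_equiv.trans)
qed

theorem group_presented_group: "group (presented_group R)"
proof (rule groupI)
  fix x assume "x \<in> carrier (presented_group R)"
  then obtain u where "x = word_class R u" by (auto simp: carrier_presented_group)
  then show "\<exists>y\<in>carrier (presented_group R). y \<otimes>\<^bsub>presented_group R\<^esub> x = \<one>\<^bsub>presented_group R\<^esub>"
    by (intro bexI[of _ "word_class R (map (\<lambda>(s, b). (s, \<not> b)) (rev u))"])
      (auto simp: carrier_presented_group one_presented_group mult_presented_group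
         word_class_eq_iff word_equiv_inverse)
qed (auto simp: carrier_presented_group one_presented_group mult_presented_group)

text \<open>The universal property of the presentation.\<close>

definition eval_word :: "('a, 'b) monoid_scheme \<Rightarrow> ('s \<Rightarrow> 'a) \<Rightarrow> 's word \<Rightarrow> 'a" where
  "eval_word H f w =
     foldr (\<lambda>(s, b) z. (if b then f s else inv\<^bsub>H\<^esub> f s) \<otimes>\<^bsub>H\<^esub> z) w \<one>\<^bsub>H\<^esub>"

context group
begin

lemma eval_word_closed: "range f \<subseteq> carrier G \<Longrightarrow> eval_word G f w \<in> carrier G"
  by (induction w) (auto simp: eval_word_def image_subset_iff)

lemma eval_word_append:
  assumes "range f \<subseteq> carrier G"
  shows "eval_word G f (u @ v) = eval_word G f u \<otimes> eval_word G f v"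
proof (induction u)
  case Nil
  show ?case using eval_word_closed[OF assms] by (simp add: eval_word_def)
next
  case (Cons a u)
  then show ?case
    using assms eval_word_closed[OF assms, of u] eval_word_closed[OF assms, of v]
    by (cases a) (auto simp: eval_word_def m_assoc image_subset_iff)
qed

lemma eval_word_equiv:
  assumes f: "range f \<subseteq> carrier G"
    and R: "\<And>l r. (l, r) \<in> R \<Longrightarrow> eval_word G f l = eval_word G f r"
  shows "word_equiv R u v \<Longrightarrow> eval_word G f u = eval_word G f v"
proof (induction rule: word_equiv.induct)
  case (cancel u s b v)
  have "f s \<in> carrier G" using f by auto
  then have "eval_word G f [(s, b), (s, \<not> b)] = \<one>"
    by (auto simp: eval_word_def)
  then show ?case
    using eval_word_closed[OF f] by (simp only: eval_word_append[OF f] l_one)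
next
  case (rel l r u v)
  then show ?case by (simp add: eval_word_append[OF f] R)
qed auto

theorem presented_group_universal:
  assumes f: "range f \<subseteq> carrier G"
    and R: "\<And>l r. (l, r) \<in> R \<Longrightarrow> eval_word G f l = eval_word G f r"
  shows "\<exists>h\<in>hom (presented_group R) G. \<forall>u. h (word_class R u) = eval_word G f u"
proof -
  define h where "h A = eval_word G f (SOME u. u \<in> A)" for A
  have h: "h (word_class R u) = eval_word G f u" for u
  proof -
    have "u \<in> word_class R u" by (simp add: word_class_def word_equiv.refl)
    then have "(SOME v. v \<in> word_class R u) \<in> word_class R u" by (rule someI)
    then show ?thesis
      unfolding h_def word_class_def using eval_word_equiv[OF f R] by fastforce
  qed
  have "h \<in> hom (presented_group R) G"
    by (auto simp: hom_def carrier_presented_group mult_presented_group h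
        eval_word_append[OF f] eval_word_closed[OF f])
  with h show ?thesis by blast
qed

end


section \<open>Metacyclic 2-groups of negative type\<close>

datatype gen = gen_x | gen_y

definition gen_pow :: "gen \<Rightarrow> nat \<Rightarrow> gen word" where
  "gen_pow s n = replicate n (s, True)"

definition negative_type_params :: "nat \<Rightarrow> nat \<Rightarrow> nat \<Rightarrow> nat \<Rightarrow> bool" where
  "negative_type_params \<alpha> \<beta> \<epsilon> \<delta> \<longleftrightarrow>
     \<alpha> > 0 \<and> \<beta> > 0 \<and> \<epsilon> \<in> {0, 1} \<and> \<delta> \<le> \<beta> \<and> \<delta> + 2 \<le> \<alpha> \<and> \<delta> + \<epsilon> \<le> \<alpha> \<and>
     (\<epsilon> = 1 \<longrightarrow> \<delta> + 1 \<le> \<beta>)"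

text \<open>
  The third relation uses the convention that \<open>x\<close> conjugated by \<open>y\<close> is \<open>y\<close>-inverse times \<open>x\<close> times \<open>y\<close>.
\<close>

definition G2_neg :: "nat \<Rightarrow> nat \<Rightarrow> nat \<Rightarrow> nat \<Rightarrow> gen word set monoid" where
  "G2_neg \<alpha> \<beta> \<epsilon> \<delta> = presented_group
     {(gen_pow gen_x (2 ^ \<alpha>), []),
      (gen_pow gen_y (2 ^ \<beta>), gen_pow gen_x (2 ^ (\<alpha> - \<epsilon>))),
      ([(gen_y, False), (gen_x, True), (gen_y, True)], gen_pow gen_x (2 ^ (\<alpha> - \<delta>) - 1))}"


section \<open>Conjugacy classes of maximal cyclic subgroups\<close>

definition cyclic_subgroups :: "('a, 'b) monoid_scheme \<Rightarrow> 'a set set" where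
  "cyclic_subgroups G = {generate G {g} | g. g \<in> carrier G}"

definition maximal_cyclic_subgroups :: "('a, 'b) monoid_scheme \<Rightarrow> 'a set set" where
  "maximal_cyclic_subgroups G =
     {H \<in> cyclic_subgroups G. \<not> (\<exists>K\<in>cyclic_subgroups G. H \<subset> K)}"

definition eta :: "('a, 'b) monoid_scheme \<Rightarrow> nat" where
  "eta G = card (orbits G (maximal_cyclic_subgroups G)
     (\<lambda>g H. inv\<^bsub>G\<^esub> g <#\<^bsub>G\<^esub> H #>\<^bsub>G\<^esub> g))"

end

theory Submission
  imports Defs
begin

text \<open>
  Write \<open>a = \<alpha> - \<delta>\<close> and \<open>r = 2 ^ a - 1\<close>. For \<open>\<delta> \<le> 1\<close> both claims say \<open>\<eta>(G) = a + 3\<close>. In this range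
  \<open>r\<^sup>2 = 1\<close> modulo \<open>2 ^ \<alpha>\<close>, so \<open>y\<^sup>2\<close> is central. Every element is \<open>x\<^sup>i y\<^sup>j\<close>, with \<open>i\<close> unique
  modulo \<open>2 ^ \<alpha>\<close> and \<open>j\<close> unique modulo 4. Commuting \<open>y\<^sup>j\<close> past \<open>x\<^sup>k\<close> multiplies \<open>k\<close> by \<open>r\<close> if
  \<open>j\<close> is odd and changes nothing if \<open>j\<close> is even.

  In a 2-group an odd power of \<open>g\<close> generates the same subgroup as \<open>g\<close>. Hence \<open>\<langle>t\<rangle>\<close> is maximal
  cyclic as soon as \<open>t\<close> is not an even power of any element
  (\<open>maximal_cyclic_subgroup_if_only_odd_pow\<close>). There are three sorts of elements.

  \<^item> If \<open>j\<close> is odd, then \<open>\<langle>x\<^sup>i y\<^sup>j\<rangle>\<close> maps onto the quotient of \<open>G\<close> by \<open>\<langle>x\<rangle>\<close>, so it is maximal.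
    Replacing the generator by a power makes \<open>j = 1\<close>, and conjugation by powers of \<open>x\<close> changes \<open>i\<close>
    by every even number. This leaves two classes, those of \<open>\<langle>y\<rangle>\<close> and \<open>\<langle>x y\<rangle>\<close>.

  \<^item> If \<open>j\<close> is even and \<open>i\<close> is odd, the element is an odd power of \<open>x\<close> or of \<open>x y\<^sup>2\<close>: two classes.

  \<^item> If \<open>i\<close> and \<open>j\<close> are even, the element is a power of \<open>x\<close> unless \<open>j = 2\<close> modulo 4. The square of \<open>x\<^sup>m y\<close> is
    \<open>x\<close> to the power \<open>2 ^ a * m\<close> times \<open>y\<^sup>2\<close>, so for \<open>j = 2\<close> the subgroup is not maximal if
    \<open>2 ^ a\<close> divides \<open>i\<close>. Otherwise \<open>i\<close> is \<open>2 ^ v\<close> times an odd number with \<open>1 \<le> v < a\<close>, and the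
    element is an odd power of \<open>x\<close> to the power \<open>2 ^ v\<close> times \<open>y\<^sup>2\<close>. Each of the \<open>a - 1\<close> values of
    \<open>v\<close> gives one class.

  The total is \<open>2 + 2 + (a - 1) = a + 3\<close>. The parity of \<open>i\<close> and the residue of \<open>j\<close> modulo 4 are
  homomorphisms to abelian groups. They separate the listed classes from each other except for the
  last \<open>a - 1\<close>, which the power of 2 dividing \<open>i\<close> separates.

  That the coordinates \<open>i\<close> and \<open>j\<close> are unique does not follow from manipulating the relations; it
  needs a group in which the relations hold and no further collapse occurs. This is
  \<open>coordinate_group\<close>, the semidirect product in explicit form, and the universal property of the
  presentation maps \<open>G\<close> to it (\<open>e_faithful\<close>).
\<close>

section \<open>Conjugacy classes of maximal cyclic subgroups by representatives\<close>

context group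
begin

lemma conj_int_pow:
  assumes a: "a \<in> carrier G" and c: "c \<in> carrier G"
  shows "(inv c \<otimes> a \<otimes> c) [^] (k::int) = inv c \<otimes> a [^] k \<otimes> c"
proof -
  have cancel: "c \<otimes> (inv c \<otimes> z) = z" if "z \<in> carrier G" for z
    using c that by (simp flip: m_assoc)
  have "(\<lambda>z. inv c \<otimes> z \<otimes> c) \<in> hom G G"
    using c by (auto simp: hom_def m_assoc cancel)
  from hom_int_pow[OF this a is_group is_group] show ?thesis by simp
qed

lemma conj_eqI:
  "c \<in> carrier G \<Longrightarrow> g \<in> carrier G \<Longrightarrow> h \<in> carrier G \<Longrightarrow> g \<otimes> c = c \<otimes> h \<Longrightarrow> inv c \<otimes> g \<otimes> c = h"
  using inv_solve_left[of h c "g \<otimes> c"] by (simp add: m_assoc)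

lemma conj_generate:
  assumes a: "a \<in> carrier G" and c: "c \<in> carrier G"
  shows "inv c <# generate G {a} #> c = generate G {inv c \<otimes> a \<otimes> c}"
proof -
  have "generate G {inv c \<otimes> a \<otimes> c} = {inv c \<otimes> a [^] k \<otimes> c |k::int. k \<in> UNIV}"
    using a c by (simp add: generate_pow conj_int_pow)
  then show ?thesis
    unfolding l_coset_def r_coset_def generate_pow[OF a] by auto
qed

lemma generate_conj_cong:
  assumes "a \<in> carrier G" "b \<in> carrier G" "c \<in> carrier G" "generate G {a} = generate G {b}"
  shows "generate G {inv c \<otimes> a \<otimes> c} = generate G {inv c \<otimes> b \<otimes> c}"
  using assms by (metis conj_generate)

lemma generate_singleton_subset_iff:
  assumes a: "a \<in> carrier G" and b: "b \<in> carrier G"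
  shows "generate G {a} \<subseteq> generate G {b} \<longleftrightarrow> (\<exists>k::int. a = b [^] k)"
proof
  assume "generate G {a} \<subseteq> generate G {b}"
  moreover have "a \<in> generate G {a}" by (simp add: generate.incl)
  ultimately show "\<exists>k::int. a = b [^] k" using b by (auto simp: generate_pow)
next
  assume "\<exists>k::int. a = b [^] k"
  then show "generate G {a} \<subseteq> generate G {b}"
    using a b by (auto simp: generate_pow int_pow_pow)
qed

text \<open>
  An odd exponent \<open>k\<close> is invertible modulo \<open>2 ^ n\<close>, so \<open>a\<close> is in turn a power of its \<open>k\<close>-th power.
\<close>

lemma generate_odd_pow:
  assumes a: "a \<in> carrier G" and order: "a [^] (2 ^ n :: int) = \<one>" and k: "odd k"
  shows "generate G {a [^] (k::int)} = generate G {a}"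
proof -
  have "coprime k (2 ^ n)" using k by simp
  then obtain u v :: int where uv: "u * k + v * 2 ^ n = 1"
    using bezout_int[of k "2 ^ n"] by (auto simp: coprime_iff_gcd_eq_1)
  have "a = a [^] (k * u + 2 ^ n * v)" using uv a by (simp add: mult.commute)
  also have "\<dots> = (a [^] k) [^] u \<otimes> (a [^] (2 ^ n :: int)) [^] v"
    using a by (simp add: int_pow_mult int_pow_pow)
  also have "\<dots> = (a [^] k) [^] u" using a by (simp add: order)
  finally have "generate G {a} \<subseteq> generate G {a [^] k}"
    using a by (subst generate_singleton_subset_iff) auto
  moreover have "generate G {a [^] k} \<subseteq> generate G {a}"
    using a by (subst generate_singleton_subset_iff) auto
  ultimately show ?thesis by auto
qed

text \<open>
  The maximality criterion for groups of 2-power exponent: if \<open>\<langle>a\<rangle> \<subseteq> \<langle>g\<rangle>\<close>, then \<open>a\<close> is a power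
  of \<open>g\<close>, by hypothesis with an odd exponent, and the two subgroups coincide.
\<close>

lemma maximal_cyclic_subgroup_if_only_odd_pow:
  assumes exponent: "\<And>g. g \<in> carrier G \<Longrightarrow> g [^] (2 ^ n :: int) = \<one>"
    and a: "a \<in> carrier G"
    and odd: "\<And>g k. g \<in> carrier G \<Longrightarrow> a = g [^] (k::int) \<Longrightarrow> odd k"
  shows "generate G {a} \<in> maximal_cyclic_subgroups G"
proof -
  have "generate G {a} = generate G {g}"
    if g: "g \<in> carrier G" and sub: "generate G {a} \<subseteq> generate G {g}" for g
  proof -
    obtain k :: int where "a = g [^] k"
      using sub a g by (auto simp: generate_singleton_subset_iff)
    with generate_odd_pow[OF g exponent[OF g] odd[OF g]] show ?thesis by simp
  qed
  with a show ?thesis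
    unfolding maximal_cyclic_subgroups_def cyclic_subgroups_def by auto
qed

lemma maximal_cyclic_subgroup_eq_generate:
  assumes "generate G {a} \<in> maximal_cyclic_subgroups G"
    and "a \<in> carrier G" "b \<in> carrier G" "a = b [^] (k::int)"
  shows "generate G {a} = generate G {b}"
proof -
  have "generate G {a} \<subseteq> generate G {b}"
    using assms generate_singleton_subset_iff by blast
  with assms show ?thesis
    unfolding maximal_cyclic_subgroups_def cyclic_subgroups_def by blast
qed

text \<open>
  Conjugating \<open>\<langle>a\<rangle>\<close> amounts to conjugating its generator. This turns equality of conjugacy classes
  of cyclic subgroups into a relation between single elements.
\<close>

lemma orbit_generate_eq_iff:
  assumes a: "a \<in> carrier G" and b: "b \<in> carrier G"
  shows "orbit G (\<lambda>g H. inv g <# H #> g) (generate G {a}) =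
           orbit G (\<lambda>g H. inv g <# H #> g) (generate G {b}) \<longleftrightarrow>
         (\<exists>c\<in>carrier G. generate G {b} = generate G {inv c \<otimes> a \<otimes> c})"
    (is "?O a = ?O b \<longleftrightarrow> ?R")
proof -
  have orb: "?O z = {generate G {inv c \<otimes> z \<otimes> c} |c. c \<in> carrier G}" if "z \<in> carrier G" for z
    unfolding orbit_def by (intro Collect_cong ex_cong1) (auto simp: conj_generate that)
  show ?thesis
  proof
    assume "?O a = ?O b"
    moreover have "generate G {b} \<in> ?O b"
      using b orb[OF b] by (auto intro!: exI[of _ "\<one>"])
    ultimately have "generate G {b} \<in> ?O a" by simp
    then show ?R unfolding orb[OF a] by blast
  next
    assume ?R
    then obtain c where c: "c \<in> carrier G" and gb: "generate G {b} = generate G {inv c \<otimes> a \<otimes> c}"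
      by auto
    have step: "generate G {inv d \<otimes> b \<otimes> d} = generate G {inv (c \<otimes> d) \<otimes> a \<otimes> (c \<otimes> d)}"
      if d: "d \<in> carrier G" for d
    proof -
      have "generate G {inv d \<otimes> b \<otimes> d} = generate G {inv d \<otimes> (inv c \<otimes> a \<otimes> c) \<otimes> d}"
        using a b c d gb by (intro generate_conj_cong) auto
      then show ?thesis using a c d by (simp add: m_assoc inv_mult_group)
    qed
    have step': "generate G {inv d \<otimes> a \<otimes> d} = generate G {inv (inv c \<otimes> d) \<otimes> b \<otimes> (inv c \<otimes> d)}"
      if d: "d \<in> carrier G" for d
    proof -
      have "c \<otimes> (inv c \<otimes> d) = d" using c d by (simp flip: m_assoc)
      then show ?thesis using step[of "inv c \<otimes> d"] c d by simp
    qed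
    have "?O b \<subseteq> ?O a"
    proof
      fix H assume "H \<in> ?O b"
      then obtain d where "d \<in> carrier G" "H = generate G {inv d \<otimes> b \<otimes> d}"
        using orb[OF b] by auto
      then show "H \<in> ?O a" unfolding orb[OF a] using step[of d] c by blast
    qed
    moreover have "?O a \<subseteq> ?O b"
    proof
      fix H assume "H \<in> ?O a"
      then obtain d where "d \<in> carrier G" "H = generate G {inv d \<otimes> a \<otimes> d}"
        using orb[OF a] by auto
      then show "H \<in> ?O b" unfolding orb[OF b] using step'[of d] c by blast
    qed
    ultimately show "?O a = ?O b" by auto
  qed
qed

text \<open>
  The form in which \<open>eta\<close> gets computed: a list of elements that generate maximal cyclic subgroups,
  reach all of them up to conjugacy, and are pairwise inequivalent.
\<close>

lemma eta_eq_card_representatives: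
  assumes T: "T \<subseteq> carrier G"
    and maximal: "\<And>t. t \<in> T \<Longrightarrow> generate G {t} \<in> maximal_cyclic_subgroups G"
    and complete: "\<And>g. g \<in> carrier G \<Longrightarrow> generate G {g} \<in> maximal_cyclic_subgroups G \<Longrightarrow>
       \<exists>t\<in>T. \<exists>c\<in>carrier G. generate G {t} = generate G {inv c \<otimes> g \<otimes> c}"
    and separate: "\<And>s t c. s \<in> T \<Longrightarrow> t \<in> T \<Longrightarrow> c \<in> carrier G \<Longrightarrow>
       generate G {t} = generate G {inv c \<otimes> s \<otimes> c} \<Longrightarrow> s = t"
  shows "eta G = card T"
proof -
  let ?O = "\<lambda>t. orbit G (\<lambda>g H. inv g <# H #> g) (generate G {t})"
  have "inj_on ?O T"
  proof (rule inj_onI)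
    fix s t assume "s \<in> T" "t \<in> T" "?O s = ?O t"
    moreover from this have "s \<in> carrier G" "t \<in> carrier G" using T by auto
    ultimately show "s = t" using separate[of s t] orbit_generate_eq_iff[of s t] by blast
  qed
  moreover have "orbits G (maximal_cyclic_subgroups G) (\<lambda>g H. inv g <# H #> g) = ?O ` T"
  proof -
    have "?O g \<in> ?O ` T"
      if g: "g \<in> carrier G" and m: "generate G {g} \<in> maximal_cyclic_subgroups G" for g
    proof -
      obtain t where t: "t \<in> T"
        and "\<exists>c\<in>carrier G. generate G {t} = generate G {inv c \<otimes> g \<otimes> c}"
        using complete[OF g m] by auto
      then have "?O g = ?O t" using T g using orbit_generate_eq_iff[of g t] by blast
      with t show ?thesis by auto
    qed
    then have "orbits G (maximal_cyclic_subgroups G) (\<lambda>g H. inv g <# H #> g) \<subseteq> ?O ` T"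
      unfolding orbits_def maximal_cyclic_subgroups_def cyclic_subgroups_def by blast
    moreover have "?O ` T \<subseteq> orbits G (maximal_cyclic_subgroups G) (\<lambda>g H. inv g <# H #> g)"
      unfolding orbits_def using maximal by blast
    ultimately show ?thesis by auto
  qed
  ultimately show ?thesis unfolding eta_def by (simp add: card_image)
qed

end

section \<open>Counting in coordinates\<close>

text \<open>
  The identity \<open>r\<^sup>2 = 1\<close> modulo \<open>2 ^ \<alpha>\<close> for \<open>r = 2 ^ a - 1\<close>: the difference \<open>r\<^sup>2 - 1 = (r + 1) (r - 1)\<close>
  is \<open>2 ^ a\<close> times an even number. This is where \<open>\<delta> \<le> 1\<close> enters.
\<close>

lemma twist_involutive:
  fixes k :: int
  assumes "1 \<le> a" "\<alpha> \<le> a + 1"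
  shows "2 ^ \<alpha> dvd (2 ^ a - 1) * ((2 ^ a - 1) * k) - k"
proof -
  have "(2 ^ a - 1) * ((2 ^ a - 1) * k) - k = 2 ^ (a + 1) * ((2 ^ (a - 1) - 1) * k)"
    using assms(1) by (cases a) (auto simp: algebra_simps)
  moreover have "(2::int) ^ \<alpha> dvd 2 ^ (a + 1)" using assms(2) by (rule le_imp_power_dvd)
  ultimately show ?thesis by simp
qed

text \<open>
  The multiplication table of the group in coordinates: \<open>e i j\<close> stands for \<open>x\<^sup>i y\<^sup>j\<close>. Integer
  coordinates up to congruence are used instead of residues, so that products and powers
  are given by formulas without reductions.
\<close>

locale negative_metacyclic = group G for G (structure) +
  fixes \<alpha> a :: nat and e :: "int \<Rightarrow> int \<Rightarrow> 'a"
  assumes a_ge: "2 \<le> a" and a_le: "a \<le> \<alpha>" and \<alpha>_le: "\<alpha> \<le> a + 1"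
    and carrier_e: "carrier G = {e i j |i j. True}"
    and e_eq_iff: "e i j = e k l \<longleftrightarrow> 2 ^ \<alpha> dvd i - k \<and> 4 dvd j - l"
    and e_mult_even: "even j \<Longrightarrow> e i j \<otimes> e k l = e (i + k) (j + l)"
    and e_mult_odd: "odd j \<Longrightarrow> e i j \<otimes> e k l = e (i + (2 ^ a - 1) * k) (j + l)"
begin

lemma e_closed [simp]: "e i j \<in> carrier G"
  using carrier_e by auto

lemma carrierE:
  assumes "g \<in> carrier G" obtains i j where "g = e i j"
  using assms carrier_e by auto

lemma one_eq_e: "\<one> = e 0 0"
  using e_mult_even[of 0 0 0 0] l_cancel_one[of "e 0 0" "e 0 0"] by simp

lemma e_pow_even: "even j \<Longrightarrow> e i j [^] (n::int) = e (n * i) (n * j)"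
proof (induction n rule: int_induct[where k = 0])
  case (step1 n)
  then show ?case by (simp add: int_pow_mult e_mult_even algebra_simps)
next
  case (step2 n)
  have "e i j [^] (n - 1) \<otimes> e i j = e i j [^] n"
    using int_pow_mult[of "e i j" "n - 1" 1] by simp
  also have "\<dots> = e ((n - 1) * i) ((n - 1) * j) \<otimes> e i j"
    using step2 by (simp add: e_mult_even algebra_simps)
  finally show ?case by simp
qed (simp add: one_eq_e)

text \<open>
  Here \<open>2 ^ a\<close> appears as \<open>1 + r\<close>.
\<close>

lemma e_square: "odd j \<Longrightarrow> e i j [^] (2::int) = e (2 ^ a * i) (2 * j)"
  using int_pow_mult[of "e i j" 1 1] by (simp add: e_mult_odd algebra_simps)

lemma e_odd_pow_double:
  "odd j \<Longrightarrow> e i j [^] (2 * n :: int) = e (n * (2 ^ a * i)) (n * (2 * j))"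
  using int_pow_pow[of "e i j" 2 n] by (simp add: e_square e_pow_even)

lemma even_cong_e: "e i j = e k l \<Longrightarrow> even (i - k)"
  using a_ge a_le dvd_trans[of "2::int" "2 ^ \<alpha>" "i - k"] by (simp add: e_eq_iff)

text \<open>
  The first coordinate is additive modulo 2 because \<open>r\<close> is odd, and the second is additive outright.
  So taking a power multiplies both coordinates, as far as these two invariants are concerned.
\<close>

lemma e_pow_parity: "\<exists>m. e i j [^] (n::int) = e m (n * j) \<and> even (m - n * i)"
proof (cases "even j")
  case True
  then show ?thesis by (auto simp: e_pow_even)
next
  case j: False
  have pow2: "even ((2::int) ^ a)" using a_ge by simp
  show ?thesis
  proof (cases "even n")
    case True
    then obtain k where "n = 2 * k" by auto
    with j pow2 show ?thesis
      using e_odd_pow_double[OF j, of i k]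
      by (auto simp: mult.left_commute mult.assoc intro!: exI[of _ "k * (2 ^ a * i)"])
  next
    case False
    then obtain k where n: "n = 2 * k + 1" by (auto elim: oddE)
    have "e i j [^] n = e i j [^] (2 * k) \<otimes> e i j" unfolding n by (simp add: int_pow_mult)
    also have "\<dots> = e (k * (2 ^ a * i) + i) (n * j)"
      using e_odd_pow_double[OF j, of i k] by (simp add: e_mult_even n algebra_simps)
    finally have "e i j [^] n = e (k * (2 ^ a * i) + i) (n * j)" .
    with pow2 show ?thesis by (auto simp: n intro!: exI[of _ "k * (2 ^ a * i) + i"])
  qed
qed

lemma e_eq_pow_parity:
  assumes "e k l = e i j [^] (n::int)"
  shows "even (k - n * i)" "4 dvd l - n * j"
proof -
  obtain m where m: "e k l = e m (n * j)" "even (m - n * i)"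
    using assms e_pow_parity by metis
  from even_cong_e[OF m(1)] m(2) show "even (k - n * i)" by simp
  from m(1) show "4 dvd l - n * j" by (simp add: e_eq_iff)
qed

lemma exponent: "g \<in> carrier G \<Longrightarrow> g [^] (2 ^ (\<alpha> + 1) :: int) = \<one>"
proof (elim carrierE)
  fix i j assume g: "g = e i j"
  have four: "(4::int) dvd 2 ^ \<alpha>" using a_ge a_le by (simp add: le_imp_power_dvd[of 2 \<alpha> "2::int", simplified])
  have "g [^] (2 ^ (\<alpha> + 1) :: int) = (if even j then e (2 ^ (\<alpha> + 1) * i) (2 ^ (\<alpha> + 1) * j)
      else e (2 ^ \<alpha> * (2 ^ a * i)) (2 ^ \<alpha> * (2 * j)))"
    using e_pow_even[of j i "2 ^ (\<alpha> + 1)"] e_odd_pow_double[of j i "2 ^ \<alpha>"] by (simp add: g)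
  also have "\<dots> = \<one>" using four by (auto simp: one_eq_e e_eq_iff)
  finally show ?thesis .
qed

lemma twist_square: "2 ^ \<alpha> dvd ((2 ^ a - 1) * ((2 ^ a - 1) * k) - k :: int)"
  using twist_involutive a_ge \<alpha>_le by simp

lemma conj_e_even:
  assumes "even j"
  shows "inv (e k l) \<otimes> e i j \<otimes> e k l = e (if even l then i else (2 ^ a - 1) * i) j"
proof (rule conj_eqI)
  have "2 ^ \<alpha> dvd i - (2 ^ a - 1) * ((2 ^ a - 1) * i)"
    using twist_square[of i] by (simp add: dvd_diff_commute)
  then show "e i j \<otimes> e k l = e k l \<otimes> e (if even l then i else (2 ^ a - 1) * i) j"
    using assms by (auto simp: e_mult_even e_mult_odd e_eq_iff)
qed auto

text \<open>
  Conjugation by \<open>x\<^sup>k\<close> adds \<open>(r - 1) k\<close> to the first coordinate. The factor \<open>2 ^ (a - 1) - 1\<close> is half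
  of \<open>r - 1\<close>; it is odd since \<open>2 \<le> a\<close>, which makes every even shift reachable.
\<close>

lemma conj_e_odd:
  assumes "odd j"
  shows "inv (e k 0) \<otimes> e i j \<otimes> e k 0 = e (i + 2 * ((2 ^ (a - 1) - 1) * k)) j"
proof (rule conj_eqI)
  have "(2::int) ^ a = 2 * 2 ^ (a - 1)" using a_ge by (cases a) auto
  then show "e i j \<otimes> e k 0 = e k 0 \<otimes> e (i + 2 * ((2 ^ (a - 1) - 1) * k)) j"
    using assms by (simp add: e_mult_even e_mult_odd algebra_simps)
qed auto

lemma conj_e_parity: "\<exists>m. inv (e k l) \<otimes> e i j \<otimes> e k l = e m j \<and> even (m - i)"
proof (cases "even j")
  case True
  have "even ((2 ^ a - 1) * i - i)" using a_ge by (simp add: algebra_simps)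
  then show ?thesis using conj_e_even[OF True] by auto
next
  case j: False
  have a: "even ((2::int) ^ a)" using a_ge by simp
  \<comment> \<open>solving \<open>i + r k = k + m\<close> or \<open>i + r k = k + r m\<close> for \<open>m\<close>, using that \<open>r\<close> is its own inverse\<close>
  define m where "m = (if even l then i + (2 ^ a - 1) * k - k else (2 ^ a - 1) * (i + (2 ^ a - 1) * k - k))"
  have "inv (e k l) \<otimes> e i j \<otimes> e k l = e m j"
  proof (rule conj_eqI)
    have "2 ^ \<alpha> dvd (i + (2 ^ a - 1) * k - k) - (2 ^ a - 1) * ((2 ^ a - 1) * (i + (2 ^ a - 1) * k - k))"
      using twist_square by (simp add: dvd_diff_commute)
    then have "odd l \<Longrightarrow> 2 ^ \<alpha> dvd i + (2 ^ a - 1) * k - (k + (2 ^ a - 1) * m)"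
      unfolding m_def by (simp add: algebra_simps)
    then show "e i j \<otimes> e k l = e k l \<otimes> e m j"
      using j by (auto simp: e_mult_even e_mult_odd e_eq_iff m_def)
  qed auto
  moreover have "even (m - i)" using a by (auto simp: m_def)
  ultimately show ?thesis by blast
qed

text \<open>
  Generators of one maximal cyclic subgroup from each conjugacy class. The exponent \<open>v\<close> stops before \<open>a\<close>
  because \<open>e (2 ^ a * m) 2\<close> is the square of \<open>e m 1\<close>.
\<close>

definition reps :: "'a set" where
  "reps = {e 0 1, e 1 1, e 1 0, e 1 2} \<union> (\<lambda>v. e (2 ^ v) 2) ` {1..<a}"

text \<open>
  On the elements with second coordinate 2, the power of 2 dividing the first coordinate (capped at
  \<open>2 ^ \<alpha>\<close>) cannot decrease under taking powers. It is the invariant that tells the \<open>e (2 ^ v) 2\<close> apart.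
\<close>

lemma pow_first_coordinate_dvd:
  assumes pow: "e u 2 = e m 2 [^] (n::int)" and m: "2 ^ v dvd m" and v: "v \<le> \<alpha>"
  shows "2 ^ v dvd u"
proof -
  have "2 ^ \<alpha> dvd u - n * m" using pow by (simp add: e_pow_even e_eq_iff)
  then have "2 ^ v dvd u - n * m" using le_imp_power_dvd[OF v, of "2::int"] by (rule dvd_trans[rotated])
  then show ?thesis using m by (metis diff_add_cancel dvd_add dvd_mult)
qed

lemma card_reps: "card reps = a + 3"
proof -
  have "inj_on (\<lambda>v. e (2 ^ v) 2) {1..<a}"
  proof (rule inj_onI)
    fix v w assume "v \<in> {1..<a}" "w \<in> {1..<a}" "e (2 ^ v) 2 = e (2 ^ w) 2"
    then show "v = w"
      using pow_first_coordinate_dvd[of "2 ^ w" "2 ^ v" 1 v] pow_first_coordinate_dvd[of "2 ^ v" "2 ^ w" 1 w] a_le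
      by (simp add: dvd_power_iff)
  qed
  then have "card ((\<lambda>v. e (2 ^ v) 2) ` {1..<a}) = a - 1" by (simp add: card_image)
  moreover have "e i j \<noteq> e (2 ^ v) 2" if "odd i \<or> odd j" "1 \<le> v" for i j v
  proof
    assume eq: "e i j = e (2 ^ v) 2"
    then have "4 dvd j - 2" by (simp add: e_eq_iff)
    then have "even j" by presburger
    moreover have "even i" using even_cong_e[OF eq] that(2) by simp
    ultimately show False using that(1) by simp
  qed
  then have "{e 0 1, e 1 1, e 1 0, e 1 2} \<inter> (\<lambda>v. e (2 ^ v) 2) ` {1..<a} = {}" by auto
  moreover have "card {e 0 1, e 1 1, e 1 0, e 1 2} = 4"
    using even_cong_e[of 0 1 1 1] by (auto simp: e_eq_iff card_insert_if)
  ultimately show ?thesis unfolding reps_def using a_ge by (subst card_Un_disjoint) auto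
qed

text \<open>
  An even power has both coordinates even, which settles the representatives with an odd coordinate.
  For \<open>e (2 ^ v) 2\<close>, an even power with second coordinate 2 modulo 4 must come from an odd \<open>j\<close>; then
  its first coordinate is divisible by \<open>2 ^ a\<close>, whereas \<open>2 ^ v\<close> is not.
\<close>

lemma rep_eq_pow_imp_odd:
  assumes t: "t \<in> reps" and pow: "t = e i j [^] (k::int)"
  shows "odd k"
proof
  assume k: "even k"
  from t consider (odd) i' j' where "t = e i' j'" "odd i' \<or> odd j'" |
    (pow2) v where "t = e (2 ^ v) 2" "v < a"
    unfolding reps_def by fastforce
  then show False
  proof cases
    case odd
    have "4 dvd j' - k * j" using e_eq_pow_parity(2)[of i' j' i j k] odd(1) pow by simp
    then have "even (j' - k * j)" using dvd_trans[of 2 4 "j' - k * j"] by simp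
    with e_eq_pow_parity(1)[of i' j' i j k] odd pow k show False by simp
  next
    case pow2
    obtain n where n: "k = 2 * n" using k by auto
    have "4 dvd 2 - 2 * n * j" using e_eq_pow_parity(2)[of "2 ^ v" 2 i j k] pow pow2(1) by (simp add: n)
    then have "odd j" by (auto simp: dvd_diff_left_iff elim!: evenE)
    then have "2 ^ \<alpha> dvd 2 ^ v - n * (2 ^ a * i)"
      using pow pow2 by (simp add: n e_odd_pow_double e_eq_iff)
    then have "2 ^ a dvd 2 ^ v - n * (2 ^ a * i)"
      using le_imp_power_dvd[OF a_le, of "2::int"] by (rule dvd_trans[rotated])
    then have "(2::int) ^ a dvd 2 ^ v" by (metis dvd_diff_left_iff dvd_mult dvd_triv_left dvd_diff_right_iff)
    then show False using pow2(2) by (simp add: dvd_power_iff)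
  qed
qed

lemma generate_e_odd_pow: "odd k \<Longrightarrow> generate G {e i j [^] (k::int)} = generate G {e i j}"
  using generate_odd_pow[OF _ exponent] by simp

text \<open>
  The \<open>j\<close>-th power of \<open>e i j\<close> generates the same subgroup and has second coordinate \<open>j\<^sup>2\<close>, which is 1
  modulo 4. Conjugating by a power of \<open>x\<close> then reduces the first coordinate to its parity.
\<close>

lemma odd_coordinate_conj_rep:
  assumes j: "odd j"
  shows "\<exists>t\<in>reps. \<exists>c\<in>carrier G. generate G {t} = generate G {inv c \<otimes> e i j \<otimes> c}"
proof -
  have step: "\<exists>t\<in>reps. \<exists>c\<in>carrier G. inv c \<otimes> e i 1 \<otimes> c = t" for i
  proof -
    let ?u = "2 ^ (a - 1) - 1 :: int"
    have "coprime ?u (2 ^ \<alpha>)" using a_ge by simp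
    then obtain x y :: int where xy: "x * ?u + y * 2 ^ \<alpha> = 1"
      using bezout_int[of ?u "2 ^ \<alpha>"] by (auto simp: coprime_iff_gcd_eq_1)
    \<comment> \<open>\<open>x\<close> inverts half of \<open>r - 1\<close>, so this shift cancels \<open>2 * (i div 2)\<close>\<close>
    define k where "k = - (i div 2) * x"
    have "(i + 2 * (?u * k)) - i mod 2 = 2 * (i div 2) * (1 - x * ?u)"
      using div_mult_mod_eq[of i 2] by (simp add: k_def algebra_simps)
    also have "\<dots> = 2 ^ \<alpha> * (2 * (i div 2) * y)"
    proof -
      have "1 - x * ?u = y * 2 ^ \<alpha>" using xy by simp
      then show ?thesis by simp
    qed
    finally have "e (i + 2 * (?u * k)) 1 = e (i mod 2) 1" unfolding e_eq_iff by simp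
    then have "inv (e k 0) \<otimes> e i 1 \<otimes> e k 0 = e (i mod 2) 1" by (simp add: conj_e_odd)
    moreover have "e (i mod 2) 1 \<in> reps" using mod2_eq_if[of i] by (auto simp: reps_def)
    ultimately show ?thesis by (metis e_closed)
  qed
  obtain m where m: "generate G {e m 1} = generate G {e i j}"
  proof -
    obtain m where "e i j [^] j = e m (j * j)" using e_pow_parity by blast
    moreover have "4 dvd j * j - 1"
    proof -
      obtain q where "j = 2 * q + 1" using j by (auto elim: oddE)
      then have "j * j - 1 = 4 * (q * q + q)" by (simp add: algebra_simps)
      then show ?thesis by simp
    qed
    then have "e m (j * j) = e m 1" by (simp add: e_eq_iff)
    ultimately show ?thesis using that[of m] generate_e_odd_pow[OF j, of i j] by simp
  qed
  obtain t c where tc: "t \<in> reps" "c \<in> carrier G" "inv c \<otimes> e m 1 \<otimes> c = t" using step by blast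
  then have "generate G {t} = generate G {inv c \<otimes> e i j \<otimes> c}"
    using generate_conj_cong[OF _ _ tc(2) m] by simp
  then show ?thesis using tc by blast
qed

text \<open>
  Every element is a power of a representative or a square of some \<open>e m 1\<close>, or has an odd second
  coordinate. In the first two cases maximality forces the subgroups of the two elements to be equal;
  in the second this leads back to the third case.
\<close>

lemma maximal_conj_rep:
  assumes g: "g \<in> carrier G" and maximal: "generate G {g} \<in> maximal_cyclic_subgroups G"
  shows "\<exists>t\<in>reps. \<exists>c\<in>carrier G. generate G {t} = generate G {inv c \<otimes> g \<otimes> c}"
proof -
  obtain i j where gij: "g = e i j" using g by (rule carrierE)
  have self: ?thesis if "t \<in> reps" "g = t [^] (k::int)" for t k
  proof -
    have "t \<in> carrier G" using that(1) by (auto simp: reps_def)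
    then have "generate G {t} = generate G {inv \<one> \<otimes> g \<otimes> \<one>}"
      using maximal_cyclic_subgroup_eq_generate[OF maximal g _ that(2)] g by simp
    with that(1) show ?thesis by blast
  qed
  consider "odd j" | "even j" "odd i" | "4 dvd j" "even i" | "4 dvd j - 2" "even i"
  proof -
    have "odd j \<or> 4 dvd j \<or> 4 dvd j - 2" by presburger
    then show ?thesis using that by blast
  qed
  then show ?thesis
  proof cases
    case 1
    then show ?thesis using odd_coordinate_conj_rep gij by simp
  next
    case 2
    then have "4 dvd j \<or> 4 dvd j - i * 2" by presburger
    then have "g = e 1 0 [^] i \<or> g = e 1 2 [^] i"
      by (auto simp: gij e_pow_even e_eq_iff)
    then show ?thesis using self[of "e 1 0"] self[of "e 1 2"] by (auto simp: reps_def)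
  next
    case 3
    then have "g = e 1 0 [^] i" by (simp add: gij e_pow_even e_eq_iff)
    then show ?thesis using self[of "e 1 0"] by (auto simp: reps_def)
  next
    case 4
    show ?thesis
    proof (cases "2 ^ a dvd i")
      case True
      then obtain m where "i = 2 ^ a * m" by auto
      then have "g = e m 1 [^] (2::int)" using 4 by (simp add: gij e_square e_eq_iff)
      then have same: "generate G {g} = generate G {e m 1}"
        using maximal_cyclic_subgroup_eq_generate[OF maximal g] by simp
      obtain t c where tc: "t \<in> reps" "c \<in> carrier G"
          "generate G {t} = generate G {inv c \<otimes> e m 1 \<otimes> c}"
        using odd_coordinate_conj_rep[of 1 m] by auto
      then have "generate G {t} = generate G {inv c \<otimes> g \<otimes> c}"
        using generate_conj_cong[OF g _ tc(2) same] by simp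
      then show ?thesis using tc by blast
    next
      case False
      then have "i \<noteq> 0" by auto
      then obtain u where u: "i = 2 ^ multiplicity 2 i * u" "odd u"
        using multiplicity_decompose'[of i 2] by auto
      let ?v = "multiplicity 2 i"
      have "?v < a" using False u(1) by (metis dvd_mult2 le_imp_power_dvd not_le)
      moreover have "1 \<le> ?v" using 4 u by (cases ?v) auto
      ultimately have rep: "e (2 ^ ?v) 2 \<in> reps" by (auto simp: reps_def)
      have "4 dvd j - u * 2" using 4 u(2) by presburger
      then have "g = e (2 ^ ?v) 2 [^] u" using u(1) by (simp add: gij e_pow_even e_eq_iff mult.commute)
      with rep show ?thesis by (rule self)
    qed
  qed
qed

text \<open>
  If \<open>t\<close> and a conjugate of \<open>s\<close> generate the same subgroup, each is a power of the other. So the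
  parities of the coordinates agree, and so does divisibility of the second coordinate by 4. These data
  determine a representative unless both have the form \<open>e (2 ^ v) 2\<close>; then \<open>pow_first_coordinate_dvd\<close>
  bounds the two exponents by each other.
\<close>

lemma reps_separate:
  assumes s: "s \<in> reps" and t: "t \<in> reps" and c: "c \<in> carrier G"
    and gen: "generate G {t} = generate G {inv c \<otimes> s \<otimes> c}"
  shows "s = t"
proof -
  obtain i j where sij: "s = e i j" and ij: "(i, j) \<in> {(0,1),(1,1),(1,0),(1,2)} \<union> (\<lambda>v. (2 ^ v, 2)) ` {1..<a}"
    using s unfolding reps_def by auto
  obtain i' j' where tij: "t = e i' j'" and ij': "(i', j') \<in> {(0,1),(1,1),(1,0),(1,2)} \<union> (\<lambda>v. (2 ^ v, 2)) ` {1..<a}"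
    using t unfolding reps_def by auto
  obtain k l where ckl: "c = e k l" using c by (rule carrierE)
  obtain m where m: "inv c \<otimes> s \<otimes> c = e m j" "even (m - i)"
    using conj_e_parity sij ckl by metis
  obtain p where p: "e i' j' = e m j [^] (p::int)"
    using gen generate_singleton_subset_iff[of "e i' j'" "e m j"] by (auto simp: m(1) tij)
  obtain q where q: "e m j = e i' j' [^] (q::int)"
    using gen generate_singleton_subset_iff[of "e m j" "e i' j'"] by (auto simp: m(1) tij)
  have par: "even (i' - p * m)" "4 dvd j' - p * j" "even (m - q * i')" "4 dvd j - q * j'"
    using e_eq_pow_parity[OF p] e_eq_pow_parity[OF q] by auto
  show ?thesis
  proof (cases "\<exists>v w. 1 \<le> v \<and> v < a \<and> 1 \<le> w \<and> w < a \<and> (i, j) = (2 ^ v, 2) \<and> (i', j') = (2 ^ w, 2)")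
    case True
    then obtain v w where vw: "1 \<le> v" "v < a" "1 \<le> w" "w < a" "i = 2 ^ v" "j = 2" "i' = 2 ^ w" "j' = 2"
      by auto
    define u :: int where "u = (if even l then 2 ^ v else (2 ^ a - 1) * 2 ^ v)"
    have u: "e m j = e u 2"
      using m(1) conj_e_even[of j k l i] vw by (simp add: sij ckl u_def)
    have "2 ^ v dvd i'"
      using pow_first_coordinate_dvd[of i' u p v] p vw a_le unfolding u by (simp add: u_def)
    then have "v \<le> w" using vw by (simp add: dvd_power_iff)
    moreover have "2 ^ w dvd u"
      using pow_first_coordinate_dvd[of u i' q w] q vw a_le unfolding u by simp
    then have "(2::int) ^ w dvd 2 ^ v"
      using a_ge by (auto simp: u_def coprime_dvd_mult_right_iff split: if_splits)
    then have "w \<le> v" by (simp add: dvd_power_iff)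
    ultimately show ?thesis using vw by (simp add: sij tij)
  next
    case False
    have "even i = even i'" using par(1,3) m(2) by auto
    moreover have "even j = even j'"
      using par(2,4) dvd_trans[of 2 4 "j' - p * j"] dvd_trans[of 2 4 "j - q * j'"] by auto
    moreover have "4 dvd j \<longleftrightarrow> 4 dvd j'"
      using par(2,4) by (metis diff_add_cancel dvd_add dvd_mult)
    ultimately show ?thesis using ij ij' False unfolding sij tij by fastforce
  qed
qed

theorem eta_negative_metacyclic: "eta G = a + 3"
proof -
  have "eta G = card reps"
  proof (rule eta_eq_card_representatives)
    show "reps \<subseteq> carrier G" by (auto simp: reps_def)
    show "generate G {t} \<in> maximal_cyclic_subgroups G" if "t \<in> reps" for t
    proof (rule maximal_cyclic_subgroup_if_only_odd_pow[OF exponent])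
      show "t \<in> carrier G" using that by (auto simp: reps_def)
      show "odd k" if "g \<in> carrier G" "t = g [^] k" for g and k :: int
        using that rep_eq_pow_imp_odd[OF \<open>t \<in> reps\<close>] by (metis carrierE)
    qed
  qed (use maximal_conj_rep reps_separate in auto)
  then show ?thesis by (simp add: card_reps)
qed

end

section \<open>A semidirect product realizing the relations\<close>

lemma (in group) eval_word_gen_pow:
  assumes "f s \<in> carrier G"
  shows "eval_word G f (gen_pow s n) = f s [^] n"
proof (induction n)
  case (Suc n)
  then show ?case using assms unfolding nat_pow_Suc2[OF assms] by (simp add: eval_word_def gen_pow_def)
qed (simp add: eval_word_def gen_pow_def)

lemma word_class_gen_pow:
  "word_class R (gen_pow s n) = word_class R [(s, True)] [^]\<^bsub>presented_group R\<^esub> n"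
proof -
  interpret P: group "presented_group R" by (rule group_presented_group)
  have carr: "word_class R u \<in> carrier (presented_group R)" for u
    by (simp add: carrier_presented_group)
  show ?thesis
  proof (induction n)
    case 0
    show ?case by (simp add: gen_pow_def one_presented_group)
  next
    case (Suc n)
    then show ?case unfolding P.nat_pow_Suc2[OF carr]
      by (simp add: mult_presented_group gen_pow_def flip: Suc)
  qed
qed

lemma word_class_inverse_letter:
  "word_class R [(s, False)] = inv\<^bsub>presented_group R\<^esub> word_class R [(s, True)]"
proof -
  interpret P: group "presented_group R" by (rule group_presented_group)
  have "word_equiv R ([] @ [(s, False), (s, \<not> False)] @ []) ([] @ [])" by (rule word_equiv.cancel)
  then have "word_class R [(s, False)] \<otimes>\<^bsub>presented_group R\<^esub> word_class R [(s, True)]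
      = \<one>\<^bsub>presented_group R\<^esub>"
    by (simp add: mult_presented_group one_presented_group word_class_eq_iff)
  then show ?thesis
    by (intro P.inv_equality[symmetric]) (auto simp: carrier_presented_group)
qed

definition twist :: "nat \<Rightarrow> int \<Rightarrow> int \<Rightarrow> int" where
  "twist a j k = (if even j then k else (2 ^ a - 1) * k)"

text \<open>
  The semidirect product of the cyclic groups of orders \<open>2 ^ \<alpha>\<close> and 4, on pairs of least residues.
\<close>

definition coordinate_group :: "nat \<Rightarrow> nat \<Rightarrow> (int \<times> int) monoid" where
  "coordinate_group \<alpha> a =
     \<lparr> carrier = {0..<2 ^ \<alpha>} \<times> {0..<4},
       monoid.mult = (\<lambda>(i, j) (k, l). ((i + twist a j k) mod 2 ^ \<alpha>, (j + l) mod 4)),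
       monoid.one = (0, 0) \<rparr>"

lemma even_mod_4: "even (j mod 4) = even (j::int)"
  by presburger

lemma twist_mod: "(i + twist a j (k mod n)) mod n = (i + twist a j k) mod n"
proof -
  have "(i + c * (k mod n)) mod n = (i + c * k) mod n" for c
    by (metis mod_add_right_eq mod_mult_right_eq)
  from this[of 1] this[of "2 ^ a - 1"] show ?thesis unfolding twist_def by simp
qed

text \<open>
  The action of the second coordinate on the first is a group action; with associativity as its
  consequence, this is what makes \<open>coordinate_group\<close> a group.
\<close>

lemma twist_twist:
  assumes "2 \<le> a" "\<alpha> \<le> a + 1"
  shows "(i + twist a j (twist a l k)) mod 2 ^ \<alpha> = (i + twist a (j + l) k) mod 2 ^ \<alpha>"
proof -
  have "2 ^ \<alpha> dvd (2 ^ a - 1) * ((2 ^ a - 1) * k) - k" using twist_involutive assms by simp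
  then have "(i + (2 ^ a - 1) * ((2 ^ a - 1) * k)) mod 2 ^ \<alpha> = (i + k) mod 2 ^ \<alpha>"
    by (simp add: mod_eq_dvd_iff)
  then show ?thesis by (auto simp: twist_def)
qed

lemma twist_0 [simp]: "twist a j 0 = 0" "twist a 0 k = k"
  by (auto simp: twist_def)

lemma twist_add: "twist a j (k + l) = twist a j k + twist a j l"
  by (auto simp: twist_def algebra_simps)

lemma group_coordinate_group:
  assumes "2 \<le> a" "\<alpha> \<le> a + 1"
  shows "group (coordinate_group \<alpha> a)"
proof (rule groupI)
  let ?H = "coordinate_group \<alpha> a"
  fix p assume "p \<in> carrier ?H"
  then obtain i j where p: "p = (i, j)" "0 \<le> i" "i < 2 ^ \<alpha>" "0 \<le> j" "j < 4"
    by (auto simp: coordinate_group_def)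
  let ?q = "((- twist a j i) mod 2 ^ \<alpha>, (- j) mod 4)"
  have "?q \<otimes>\<^bsub>?H\<^esub> p = \<one>\<^bsub>?H\<^esub>"
    by (simp add: coordinate_group_def p twist_def even_mod_4 mod_simps)
  moreover have "?q \<in> carrier ?H" by (simp add: coordinate_group_def)
  ultimately show "\<exists>q\<in>carrier ?H. q \<otimes>\<^bsub>?H\<^esub> p = \<one>\<^bsub>?H\<^esub>" by blast
next
  let ?H = "coordinate_group \<alpha> a"
  fix p q s assume "p \<in> carrier ?H" "q \<in> carrier ?H" "s \<in> carrier ?H"
  obtain i j k l m n where pqs: "p = (i, j)" "q = (k, l)" "s = (m, n)" by (metis surj_pair)
  have "((i + twist a j k) mod 2 ^ \<alpha> + twist a ((j + l) mod 4) m) mod 2 ^ \<alpha> =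
      (i + twist a j k + twist a (j + l) m) mod 2 ^ \<alpha>"
    by (simp add: twist_def even_mod_4 mod_simps)
  also have "\<dots> = (i + twist a j k + twist a j (twist a l m)) mod 2 ^ \<alpha>"
    using twist_twist[OF assms] by simp
  also have "\<dots> = (i + twist a j ((k + twist a l m) mod 2 ^ \<alpha>)) mod 2 ^ \<alpha>"
    by (simp add: twist_mod twist_add add.assoc)
  finally show "p \<otimes>\<^bsub>?H\<^esub> q \<otimes>\<^bsub>?H\<^esub> s = p \<otimes>\<^bsub>?H\<^esub> (q \<otimes>\<^bsub>?H\<^esub> s)"
    by (simp add: coordinate_group_def pqs mod_simps add.assoc)
qed (auto simp: coordinate_group_def)

lemma coordinate_group_pow:
  assumes "2 \<le> \<alpha>"
  shows "(1, 0) [^]\<^bsub>coordinate_group \<alpha> a\<^esub> (n::nat) = (int n mod 2 ^ \<alpha>, 0)"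
    and "(0, 1) [^]\<^bsub>coordinate_group \<alpha> a\<^esub> (n::nat) = (0, int n mod 4)"
proof -
  show "(1, 0) [^]\<^bsub>coordinate_group \<alpha> a\<^esub> n = (int n mod 2 ^ \<alpha>, 0)"
    by (induction n) (simp_all add: coordinate_group_def twist_def mod_simps add.commute)
  show "(0, 1) [^]\<^bsub>coordinate_group \<alpha> a\<^esub> n = (0, int n mod 4)"
    by (induction n) (simp_all add: coordinate_group_def twist_def mod_simps add.commute)
qed

section \<open>Coordinates on the presented group\<close>

definition relators :: "nat \<Rightarrow> nat \<Rightarrow> (gen word \<times> gen word) set" where
  "relators \<alpha> a =
     {(gen_pow gen_x (2 ^ \<alpha>), []),
      (gen_pow gen_y 4, gen_pow gen_x (2 ^ \<alpha>)),
      ([(gen_y, False), (gen_x, True), (gen_y, True)], gen_pow gen_x (2 ^ a - 1))}"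

text \<open>
  Here \<open>G\<close> is a parameter equal to the presented group, so that the locale can be interpreted
  directly at \<open>G2_neg\<close>, with \<open>a = \<alpha> - \<delta>\<close>.
\<close>

locale presented_negative_metacyclic =
  fixes \<alpha> a :: nat and G (structure)
  assumes a_ge: "2 \<le> a" and a_le: "a \<le> \<alpha>" and \<alpha>_le: "\<alpha> \<le> a + 1"
    and G: "G = presented_group (relators \<alpha> a)"
begin

definition x where "x = word_class (relators \<alpha> a) [(gen_x, True)]"
definition y where "y = word_class (relators \<alpha> a) [(gen_y, True)]"

sublocale group G
  unfolding G by (rule group_presented_group)

lemma xy_closed [simp]: "x \<in> carrier G" "y \<in> carrier G"
  by (auto simp: G x_def y_def carrier_presented_group)

lemma relation: "(u, v) \<in> relators \<alpha> a \<Longrightarrow> word_class (relators \<alpha> a) u = word_class (relators \<alpha> a) v"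
  using word_equiv.rel[of u v "relators \<alpha> a" "[]" "[]"] by (simp add: word_class_eq_iff)

lemma word_class_pow:
  "word_class (relators \<alpha> a) (gen_pow gen_x n) = x [^] n"
  "word_class (relators \<alpha> a) (gen_pow gen_y n) = y [^] n"
  by (simp_all add: G x_def y_def word_class_gen_pow)

lemma word_class_Nil: "word_class (relators \<alpha> a) [] = \<one>"
  by (simp add: G one_presented_group)

lemma x_pow: "x [^] (2 ^ \<alpha> :: int) = \<one>"
proof -
  have "(gen_pow gen_x (2 ^ \<alpha>), []) \<in> relators \<alpha> a" by (simp add: relators_def)
  from relation[OF this] have "x [^] (2 ^ \<alpha> :: nat) = \<one>"
    by (simp only: word_class_pow word_class_Nil)
  then show ?thesis using int_pow_int[of G x "2 ^ \<alpha>"] by simp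
qed

lemma y_pow: "y [^] (4 :: int) = \<one>"
proof -
  have "(gen_pow gen_y 4, gen_pow gen_x (2 ^ \<alpha>)) \<in> relators \<alpha> a" by (simp add: relators_def)
  from relation[OF this] have "y [^] (4 :: nat) = x [^] (2 ^ \<alpha> :: nat)"
    by (simp only: word_class_pow)
  then show ?thesis using x_pow int_pow_int[of G x "2 ^ \<alpha>"] int_pow_int[of G y 4] by simp
qed

lemma conj_x: "inv y \<otimes> x \<otimes> y = x [^] (2 ^ a - 1 :: int)"
proof -
  let ?w = "[(gen_y, False), (gen_x, True), (gen_y, True)]"
  have "(?w, gen_pow gen_x (2 ^ a - 1)) \<in> relators \<alpha> a" by (simp add: relators_def)
  from relation[OF this] have "word_class (relators \<alpha> a) ?w = x [^] (2 ^ a - 1 :: nat)"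
    by (simp only: word_class_pow)
  moreover have "word_class (relators \<alpha> a) ?w = inv y \<otimes> x \<otimes> y"
    by (simp add: G x_def y_def mult_presented_group flip: word_class_inverse_letter)
  ultimately show ?thesis using int_pow_int[of G x "2 ^ a - 1"] by (simp add: of_nat_diff)
qed

lemma x_pow_cong: "2 ^ \<alpha> dvd i - k \<Longrightarrow> x [^] i = x [^] (k::int)"
proof -
  assume "2 ^ \<alpha> dvd i - k"
  then obtain c where "i = k + 2 ^ \<alpha> * c" by (auto elim!: dvdE simp: algebra_simps)
  then have "x [^] i = x [^] k \<otimes> (x [^] (2 ^ \<alpha> :: int)) [^] c"
    by (simp add: int_pow_mult int_pow_pow)
  then show ?thesis by (simp add: x_pow)
qed

lemma y_pow_cong: "4 dvd j - l \<Longrightarrow> y [^] j = y [^] (l::int)"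
proof -
  assume "4 dvd j - l"
  then obtain c where "j = l + 4 * c" by (auto elim!: dvdE simp: algebra_simps)
  then have "y [^] j = y [^] l \<otimes> (y [^] (4 :: int)) [^] c"
    by (simp add: int_pow_mult int_pow_pow)
  then show ?thesis by (simp add: y_pow)
qed

lemma x_pow_cong': "i mod 2 ^ \<alpha> = k mod 2 ^ \<alpha> \<Longrightarrow> x [^] i = x [^] (k::int)"
  by (simp add: x_pow_cong mod_eq_dvd_iff)

lemma x_y: "x [^] (k::int) \<otimes> y = y \<otimes> x [^] ((2 ^ a - 1) * k)"
proof -
  have "inv y \<otimes> (x [^] k \<otimes> y) = x [^] ((2 ^ a - 1) * k)"
    using conj_int_pow[of x y k] by (simp add: conj_x int_pow_pow m_assoc)
  then show ?thesis by (simp add: inv_solve_left')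
qed

text \<open>
  Commuting \<open>y\<close> to the right also multiplies the exponent by \<open>r\<close>, since \<open>r\<close> is its own inverse.
\<close>

lemma y_x: "y \<otimes> x [^] (k::int) = x [^] ((2 ^ a - 1) * k) \<otimes> y"
  using x_y[of "(2 ^ a - 1) * k"] x_pow_cong'[of "(2 ^ a - 1) * ((2 ^ a - 1) * k)" k]
    twist_twist[of a \<alpha> 0 1 1 k] a_ge a_le \<alpha>_le by (simp add: twist_def)

lemma ypow_x: "y [^] (j::int) \<otimes> x [^] (k::int) = x [^] (twist a j k) \<otimes> y [^] j"
proof -
  have nat: "y [^] n \<otimes> x [^] k = x [^] (twist a (int n) k) \<otimes> y [^] n" for n :: nat and k
  proof (induction n arbitrary: k)
    case (Suc n)
    have "y [^] Suc n \<otimes> x [^] k = y [^] n \<otimes> x [^] ((2 ^ a - 1) * k) \<otimes> y"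
      by (simp add: m_assoc y_x)
    also have "\<dots> = x [^] twist a (int n) (twist a 1 k) \<otimes> y [^] Suc n"
      by (simp add: Suc twist_def m_assoc)
    also have "x [^] twist a (int n) (twist a 1 k) = x [^] twist a (int (Suc n)) k"
      using twist_twist[of a \<alpha> 0 "int n" 1 k] a_ge a_le \<alpha>_le by (intro x_pow_cong') (simp add: add.commute)
    finally show ?case .
  qed simp
  \<comment> \<open>a negative exponent of \<open>y\<close> is traded for a natural number, as \<open>y\<close> has order dividing 4\<close>
  have "y [^] j = y [^] nat (j mod 4)"
    using y_pow_cong[of j "j mod 4"] int_pow_int[of G y "nat (j mod 4)"] by simp
  moreover have "twist a (int (nat (j mod 4))) k = twist a j k" by (simp add: twist_def even_mod_4)
  ultimately show ?thesis using nat[of "nat (j mod 4)" k] by simp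
qed

definition e where "e i j = x [^] (i::int) \<otimes> y [^] (j::int)"

lemma e_mult: "e i j \<otimes> e k l = e (i + twist a j k) (j + l)"
proof -
  have "e i j \<otimes> e k l = x [^] i \<otimes> (y [^] j \<otimes> x [^] k) \<otimes> y [^] l"
    by (simp add: e_def m_assoc)
  then show ?thesis unfolding ypow_x by (simp add: e_def m_assoc int_pow_mult)
qed

lemma carrier_e: "carrier G = {e i j |i j. True}"
proof -
  have "\<exists>i j. word_class (relators \<alpha> a) u = e i j" for u
  proof (induction u)
    case Nil
    have "word_class (relators \<alpha> a) [] = e 0 0" by (simp add: e_def word_class_Nil)
    then show ?case by blast
  next
    case (Cons z u)
    have letters:
      "word_class (relators \<alpha> a) [(gen_x, True)] = e 1 0"
      "word_class (relators \<alpha> a) [(gen_y, True)] = e 0 1"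
      "word_class (relators \<alpha> a) [(gen_x, False)] = e (-1) 0"
      "word_class (relators \<alpha> a) [(gen_y, False)] = e 0 (-1)"
      using word_class_inverse_letter[of "relators \<alpha> a"]
      by (simp_all add: e_def int_pow_neg flip: x_def y_def G)
    obtain s b where z: "z = (s, b)" by (cases z)
    obtain i j where "word_class (relators \<alpha> a) [z] = e i j"
      unfolding z using letters by (cases s; cases b) simp_all
    moreover obtain k l where "word_class (relators \<alpha> a) u = e k l" using Cons by blast
    moreover have "word_class (relators \<alpha> a) (z # u) = word_class (relators \<alpha> a) [z] \<otimes> word_class (relators \<alpha> a) u"
      by (simp add: G mult_presented_group)
    ultimately have "word_class (relators \<alpha> a) (z # u) = e (i + twist a j k) (j + l)"
      by (simp add: e_mult)
    then show ?case by blast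
  qed
  moreover have "e i j \<in> carrier G" for i j by (simp add: e_def)
  ultimately show ?thesis by (auto simp: G carrier_presented_group)
qed

text \<open>
  Sending \<open>x\<close> to \<open>(1, 0)\<close> and \<open>y\<close> to \<open>(0, 1)\<close> respects the relations in \<open>coordinate_group\<close>, so it
  extends to a homomorphism, and this homomorphism maps \<open>x\<^sup>i y\<^sup>j\<close> to the residues of \<open>i\<close> and \<open>j\<close>.
\<close>

lemma e_faithful:
  assumes "e i j = \<one>"
  shows "2 ^ \<alpha> dvd i \<and> 4 dvd j"
proof -
  let ?H = "coordinate_group \<alpha> a"
  interpret H: group ?H using a_ge a_le \<alpha>_le by (intro group_coordinate_group) auto
  have \<alpha>2: "2 \<le> \<alpha>" using a_ge a_le by simp
  have one_less: "1 < (2::int) ^ \<alpha>" using \<alpha>2 by simp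
  define f :: "gen \<Rightarrow> int \<times> int" where "f g = (case g of gen_x \<Rightarrow> (1, 0) | gen_y \<Rightarrow> (0, 1))" for g
  have f: "range f \<subseteq> carrier ?H"
    using one_less by (auto simp: f_def coordinate_group_def split: gen.splits)
  have fs: "f s \<in> carrier ?H" for s using f by auto
  have eval_letter: "eval_word ?H f [(s, True)] = f s" for s
    using fs[of s] by (simp add: eval_word_def)
  have "eval_word ?H f u = eval_word ?H f v" if "(u, v) \<in> relators \<alpha> a" for u v
  proof -
    have f_pow: "f gen_x [^]\<^bsub>?H\<^esub> n = (int n mod 2 ^ \<alpha>, 0)" "f gen_y [^]\<^bsub>?H\<^esub> n = (0, int n mod 4)" for n :: nat
      by (simp_all add: f_def coordinate_group_pow[OF \<alpha>2])
    have Nil: "eval_word ?H f [] = (0, 0)" by (simp add: eval_word_def coordinate_group_def)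
    let ?w = "[(gen_y, False), (gen_x, True), (gen_y, True)]" and ?r = "int (2 ^ a - 1) mod 2 ^ \<alpha>"
    have "eval_word ?H f ?w = inv\<^bsub>?H\<^esub> f gen_y \<otimes>\<^bsub>?H\<^esub> (f gen_x \<otimes>\<^bsub>?H\<^esub> f gen_y)"
      using fs by (simp add: eval_word_def)
    also have "\<dots> = (?r, 0)"
    proof -
      have "(twist a 1 ?r) mod 2 ^ \<alpha> = 1"
        using twist_mod[of 0 a 1 "2 ^ a - 1" "2 ^ \<alpha>"] twist_twist[of a \<alpha> 0 1 1 1] a_ge a_le \<alpha>_le one_less
        by (simp add: twist_def of_nat_diff)
      then have "f gen_x \<otimes>\<^bsub>?H\<^esub> f gen_y = f gen_y \<otimes>\<^bsub>?H\<^esub> (?r, 0)"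
        using one_less \<alpha>2 by (simp add: f_def coordinate_group_def)
      moreover have "(?r, 0) \<in> carrier ?H" by (simp add: coordinate_group_def)
      ultimately show ?thesis using fs H.inv_solve_left'[of _ "f gen_y"] by simp
    qed
    finally have "eval_word ?H f ?w = eval_word ?H f (gen_pow gen_x (2 ^ a - 1))"
      by (simp add: H.eval_word_gen_pow fs f_pow)
    with that show ?thesis
      by (auto simp: relators_def H.eval_word_gen_pow fs f_pow Nil)
  qed
  then obtain h where h: "h \<in> hom G ?H" and hw: "\<And>u. h (word_class (relators \<alpha> a) u) = eval_word ?H f u"
    using H.presented_group_universal[OF f, of "relators \<alpha> a"] unfolding G by blast
  interpret h: group_hom G ?H h using h by unfold_locales
  have hx: "h x = f gen_x" "h y = f gen_y" by (simp_all add: hw x_def y_def eval_letter)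
  have "h (e i j) = h (x [^] (i mod 2 ^ \<alpha>)) \<otimes>\<^bsub>?H\<^esub> h (y [^] (j mod 4))"
    using x_pow_cong[of i "i mod 2 ^ \<alpha>"] y_pow_cong[of j "j mod 4"] by (simp add: e_def)
  also have "\<dots> = f gen_x [^]\<^bsub>?H\<^esub> nat (i mod 2 ^ \<alpha>) \<otimes>\<^bsub>?H\<^esub> f gen_y [^]\<^bsub>?H\<^esub> nat (j mod 4)"
    using int_pow_int[of ?H "f gen_x" "nat (i mod 2 ^ \<alpha>)"] int_pow_int[of ?H "f gen_y" "nat (j mod 4)"]
    by (simp add: h.hom_int_pow hx)
  also have "\<dots> = (i mod 2 ^ \<alpha>, j mod 4)"
    by (simp add: f_def coordinate_group_pow[OF \<alpha>2]) (simp add: coordinate_group_def)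
  finally have "(i mod 2 ^ \<alpha>, j mod 4) = (0, 0)"
    using assms by (simp add: coordinate_group_def)
  then show ?thesis by (auto simp: dvd_eq_mod_eq_0)
qed

lemma e_eq_iff: "e i j = e k l \<longleftrightarrow> 2 ^ \<alpha> dvd i - k \<and> 4 dvd j - l"
proof
  assume eq: "e i j = e k l"
  have shift: "x [^] (- k) \<otimes> e i' j' \<otimes> y [^] (- l) = e (i' - k) (j' - l)" for i' j'
    using e_mult[of "-k" 0 i' j'] e_mult[of "i' - k" j' 0 "-l"] by (simp add: e_def)
  have "e (i - k) (j - l) = e (k - k) (l - l)" unfolding shift[symmetric] eq ..
  then have "e (i - k) (j - l) = \<one>" by (simp add: e_def)
  then show "2 ^ \<alpha> dvd i - k \<and> 4 dvd j - l" by (rule e_faithful)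
qed (simp add: e_def x_pow_cong[of i k] y_pow_cong[of j l])

sublocale coords: negative_metacyclic G \<alpha> a e
  using a_ge a_le \<alpha>_le by unfold_locales (auto simp: carrier_e e_eq_iff e_mult twist_def)

end

theorem lemma4p3:
  fixes \<alpha> \<delta> :: nat
  assumes "negative_type_params \<alpha> 2 0 \<delta>"
  shows "(\<delta> = 0 \<longrightarrow> eta (G2_neg \<alpha> 2 0 \<delta>) = \<alpha> + 3) \<and>
         (\<delta> = 1 \<longrightarrow> eta (G2_neg \<alpha> 2 0 \<delta>) = \<alpha> + 2)"
proof -
  have "eta (G2_neg \<alpha> 2 0 \<delta>) = \<alpha> - \<delta> + 3" if "\<delta> \<le> 1"
  proof -
    interpret presented_negative_metacyclic \<alpha> "\<alpha> - \<delta>" "G2_neg \<alpha> 2 0 \<delta>"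
      using assms that
      by unfold_locales (auto simp: negative_type_params_def relators_def G2_neg_def)
    show ?thesis by (rule coords.eta_negative_metacyclic)
  qed
  moreover have "2 \<le> \<alpha> - \<delta>" "\<delta> \<le> \<alpha>" using assms by (auto simp: negative_type_params_def)
  ultimately show ?thesis by auto
qed

end
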